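(* Let $P_S>0$, $P_J\geq 0$, $\sigma^2=P_N>0$, and let $M\geq 2$ be a power of $2$. Consider the channel $R=S+e^{j\Theta}J+N$, where $S$ and $J$ are complex random variables with distributions $F_S$ and $F_J$ respectively, $\Theta$ is uniformly distributed on $\{2\pi i/M: i=0,\dots,M-1\}$, $N\sim\mathcal{CN}(0,P_N)$, and $S,J,\Theta,N$ are mutually independent. Write $\phi(F_S,F_J)=I(S;R)$ for the mutual information. Then $$\max_{F_S:\ \mathbb{E}|S|^2\le P_S}\ \min_{F_J:\ \mathbb{E}|J|^2\le P_J}\ \phi(F_S,F_J)=\log\Big(1+\frac{P_S}{P_J+P_N}\Big),$$ and the pair $(F_S^*,F_J^* )=(\mathcal{CN}(0,P_S),\mathcal{CN}(0,P_J))$ is a saddle point: for all $F_S$ with $\mathbb{E}|S|^2\le P_S$ and all $F_J$ with $\mathbb{E}|J|^2\le P_J$, $\phi(F_S,F_J^* )\le\phi(F_S^*,F_J^* )\le\phi(F_S^*,F_J)$, with $\phi(F_S^*,F_J^* )=\log(1+P_S/(P_J+P_N))$.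
   Context: $\mathcal{CN}(0,P)$ denotes the circularly symmetric complex Gaussian distribution with mean $0$ and variance $E|X|^2=P$. The logarithm is taken in a fixed base (base $2$ gives bits per symbol). *)

theory Defs
  imports "HOL-Probability.Probability"
begin

definition complex_gaussian :: "real \<Rightarrow> complex measure" where
  "complex_gaussian P =
     (if P = 0 then return borel 0
      else distr (density lborel (normal_density 0 (sqrt (P / 2)))
                  \<Otimes>\<^sub>M density lborel (normal_density 0 (sqrt (P / 2))))
                 borel (\<lambda>(x, y). Complex x y))"

definition phase_measure :: "nat \<Rightarrow> complex measure" where
  "phase_measure M = distr (measure_pmf (pmf_of_set {..<M})) borel
                       (\<lambda>i. cis (2 * pi * real i / real M))"

definition power_dists :: "real \<Rightarrow> complex measure set" where
  "power_dists P = {F. prob_space F \<and> sets F = sets (borel :: complex measure) \<and>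
       integrable F (\<lambda>z. (cmod z)\<^sup>2) \<and> (\<integral>z. (cmod z)\<^sup>2 \<partial>F) \<le> P}"

definition channel_space ::
  "nat \<Rightarrow> real \<Rightarrow> complex measure \<Rightarrow> complex measure \<Rightarrow> (complex \<times> complex \<times> complex \<times> complex) measure" where
  "channel_space M PN FS FJ = FS \<Otimes>\<^sub>M (FJ \<Otimes>\<^sub>M (phase_measure M \<Otimes>\<^sub>M complex_gaussian PN))"

definition channel_output :: "complex \<times> complex \<times> complex \<times> complex \<Rightarrow> complex" where
  "channel_output = (\<lambda>(s, j, u, n). s + u * j + n)"

definition phi :: "real \<Rightarrow> nat \<Rightarrow> real \<Rightarrow> complex measure \<Rightarrow> complex measure \<Rightarrow> real" where
  "phi b M PN FS FJ =
     prob_space.mutual_information (channel_space M PN FS FJ) b borel borel fst channel_output"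

end

theory Submission
  imports Defs
begin

text \<open>
  Given \<open>S\<close>, the output is \<open>R = S + W\<close> with effective noise \<open>W = e\<^sup>j\<^sup>\<Theta> J + N\<close>. As a Gaussian
  mixture, \<open>W\<close> has a density \<open>q\<close> between \<open>c exp (- B \<bar>z\<bar>\<^sup>2)\<close> and a constant, so every logarithm
  below is integrable, and \<open>I(S; R) = h(R) - h(W)\<close>. Both saddle point inequalities are instances of
  Gibbs' inequality. Let \<open>g\<^sub>P\<close> be the density of \<open>CN(0, P)\<close>, let \<open>f\<close> be that of \<open>R\<close>, and put
  \<open>Q = P\<^sub>J + P\<^sub>N\<close> and \<open>T = P\<^sub>S + Q\<close>.

  If \<open>J\<close> is Gaussian, then \<open>W\<close> has law \<open>CN(0, Q)\<close> by circular symmetry, and \<open>h(R)\<close> is largest for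
  Gaussian \<open>R\<close>. If \<open>S\<close> is Gaussian, then, relative to the law of \<open>S\<close>, \<open>g\<^sub>Q (r - s) / g\<^sub>T r\<close> is the
  density of the input given the output \<open>r\<close> when the noise is \<open>CN(0, Q)\<close>, and comparing the joint
  density \<open>q (r - s)\<close> with \<open>f r * g\<^sub>Q (r - s) / g\<^sub>T r\<close> yields
  \<open>I(S; R) \<ge> E log (g\<^sub>Q W / g\<^sub>T R)\<close>, which depends on second moments only.
\<close>

subsection \<open>Product and Lebesgue measures\<close>

lemma (in pair_prob_space) distr_pair_snd: "distr (M1 \<Otimes>\<^sub>M M2) M2 snd = M2"
proof -
  have "distr (M1 \<Otimes>\<^sub>M M2) M2 snd = distr (M2 \<Otimes>\<^sub>M M1) M2 (snd \<circ> (\<lambda>(x, y). (y, x)))"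
    by (subst distr_pair_swap, rule distr_distr) simp_all
  also have "snd \<circ> (\<lambda>(x, y). (y, x)) = fst"
    by auto
  finally show ?thesis
    by (simp add: M1.distr_pair_fst)
qed

lemma (in pair_prob_space)
  fixes f :: "_ \<Rightarrow> 'c::{banach, second_countable_topology}"
  assumes "integrable M1 f"
  shows integrable_comp_fst: "integrable (M1 \<Otimes>\<^sub>M M2) (\<lambda>p. f (fst p))"
    and integral_comp_fst: "(\<integral>p. f (fst p) \<partial>(M1 \<Otimes>\<^sub>M M2)) = (\<integral>x. f x \<partial>M1)"
  using assms integrable_distr_eq[OF measurable_fst, of f M1 M2]
    integral_distr[OF measurable_fst, of f M1 M2]
  by (simp_all add: M2.distr_pair_fst)

lemma (in pair_prob_space)
  fixes f :: "_ \<Rightarrow> 'c::{banach, second_countable_topology}"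
  assumes "integrable M2 f"
  shows integrable_comp_snd: "integrable (M1 \<Otimes>\<^sub>M M2) (\<lambda>p. f (snd p))"
    and integral_comp_snd: "(\<integral>p. f (snd p) \<partial>(M1 \<Otimes>\<^sub>M M2)) = (\<integral>x. f x \<partial>M2)"
  using assms integrable_distr_eq[OF measurable_snd, of f M2 M1]
    integral_distr[OF measurable_snd, of f M2 M1]
  by (simp_all add: distr_pair_snd)

lemma distr_pair_assoc:
  assumes "sigma_finite_measure L" "sigma_finite_measure M" "sigma_finite_measure N"
  shows "distr ((L \<Otimes>\<^sub>M M) \<Otimes>\<^sub>M N) (L \<Otimes>\<^sub>M (M \<Otimes>\<^sub>M N)) (\<lambda>((x, y), z). (x, y, z)) = L \<Otimes>\<^sub>M (M \<Otimes>\<^sub>M N)"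
    (is "?L = ?R")
proof (rule measure_eqI)
  interpret M: sigma_finite_measure M by fact
  interpret N: sigma_finite_measure N by fact
  interpret MN: pair_sigma_finite M N ..
  fix A assume "A \<in> sets ?L"
  then have [measurable]: "A \<in> sets ?R"
    by simp
  have "emeasure ?L A =
      (\<integral>\<^sup>+p. indicator A (fst (fst p), snd (fst p), snd p) \<partial>((L \<Otimes>\<^sub>M M) \<Otimes>\<^sub>M N))"
    by (subst nn_integral_indicator[symmetric], simp, subst nn_integral_distr)
      (auto simp: split_beta')
  also have "\<dots> = (\<integral>\<^sup>+x. \<integral>\<^sup>+y. \<integral>\<^sup>+z. indicator A (x, y, z) \<partial>N \<partial>M \<partial>L)"
    by (simp add: N.nn_integral_fst[symmetric] M.nn_integral_fst[symmetric])
  also have "\<dots> = (\<integral>\<^sup>+x. \<integral>\<^sup>+p. indicator A (x, p) \<partial>(M \<Otimes>\<^sub>M N) \<partial>L)"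
    by (intro nn_integral_cong) (simp add: N.nn_integral_fst[symmetric])
  also have "\<dots> = emeasure ?R A"
    by (simp add: MN.emeasure_pair_measure)
  finally show "emeasure ?L A = emeasure ?R A" .
qed simp

lemma (in prob_space) mutual_information_distr:
  assumes [measurable]: "T \<in> M \<rightarrow>\<^sub>M N" "X \<in> N \<rightarrow>\<^sub>M S" "Y \<in> N \<rightarrow>\<^sub>M S'"
  shows "prob_space.mutual_information (distr M N T) b S S' X Y =
    mutual_information b S S' (\<lambda>x. X (T x)) (\<lambda>x. Y (T x))"
proof -
  interpret N: prob_space "distr M N T" by (rule prob_space_distr) fact
  show ?thesis
    by (simp add: N.mutual_information_def mutual_information_def distr_distr comp_def)
qed

lemma integral_lborel_odd:
  fixes f :: "'a::euclidean_space \<Rightarrow> 'b::{banach, second_countable_topology}"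
  assumes [measurable]: "f \<in> borel_measurable borel" and odd: "\<And>x. f (- x) = - f x"
  shows "(\<integral>x. f x \<partial>lborel) = 0"
proof -
  have "lborel = distr lborel borel (uminus :: 'a \<Rightarrow> 'a)"
    using lborel_affine[of "- 1" "0::'a"] by (simp add: density_1)
  then have "(\<integral>x. f x \<partial>lborel) = (\<integral>x. f (- x) \<partial>lborel)"
    using integral_distr[of uminus lborel borel f] by simp
  then have "2 *\<^sub>R (\<integral>x. f x \<partial>lborel) = 0"
    by (simp add: odd scaleR_2 eq_neg_iff_add_eq_0)
  then show ?thesis
    by simp
qed

lemma nn_integral_lborel_translate:
  fixes c :: "'a::euclidean_space"
  assumes [measurable]: "f \<in> borel_measurable borel"
  shows "(\<integral>\<^sup>+x. f (c + x) \<partial>lborel) = (\<integral>\<^sup>+x. f x \<partial>lborel)"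
  by (subst (2) lborel_distr_plus[of c, symmetric], subst nn_integral_distr) auto

subsection \<open>Laws of finite power and their independent sums\<close>

locale finite_power = prob_space M for M :: "'a::euclidean_space measure" +
  assumes sets_eq_borel [measurable_cong, simp]: "sets M = sets borel"
    and integrable_norm_squared: "integrable M (\<lambda>x. (norm x)\<^sup>2)"
begin

lemma integrable_ident: "integrable M (\<lambda>x. x)"
proof -
  have "integrable M (\<lambda>x. norm x)"
    by (rule square_integrable_imp_integrable) (simp_all add: integrable_norm_squared)
  then show ?thesis
    by (rule Bochner_Integration.integrable_bound) simp_all
qed

end

definition mean_power :: "'a::euclidean_space measure \<Rightarrow> real" where
  "mean_power M = (\<integral>x. (norm x)\<^sup>2 \<partial>M)"

lemma mean_power_nonneg: "0 \<le> mean_power M"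
  by (simp add: mean_power_def)

text \<open>The library constant \<^const>\<open>convolution\<close> is confined to ordered Euclidean spaces,
  which excludes the complex plane.\<close>

definition indep_sum :: "'a::euclidean_space measure \<Rightarrow> 'a measure \<Rightarrow> 'a measure" where
  "indep_sum X Y = distr (X \<Otimes>\<^sub>M Y) borel (\<lambda>(x, y). x + y)"

lemma sets_indep_sum [measurable_cong, simp]: "sets (indep_sum X Y) = sets borel"
  by (simp add: indep_sum_def)

lemma norm_add_squared: "(norm (x + y))\<^sup>2 = (norm x)\<^sup>2 + (norm y)\<^sup>2 + 2 * (x \<bullet> y)"
  for x y :: "'a::real_inner"
  by (simp add: power2_norm_eq_inner inner_add_left inner_add_right inner_commute)

locale finite_power_pair = X: finite_power X + Y: finite_power Y
  for X Y :: "'a::euclidean_space measure"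
begin

sublocale pair_prob_space X Y ..

lemmas integrable_norm_squared_comp =
  integrable_comp_fst[OF X.integrable_norm_squared]
  integrable_comp_snd[OF Y.integrable_norm_squared]

lemma integrable_inner: "integrable (X \<Otimes>\<^sub>M Y) (\<lambda>p. fst p \<bullet> snd p)"
proof (rule Bochner_Integration.integrable_bound)
  show "integrable (X \<Otimes>\<^sub>M Y) (\<lambda>p. (norm (fst p))\<^sup>2 + (norm (snd p))\<^sup>2)"
    by (intro Bochner_Integration.integrable_add integrable_norm_squared_comp)
  have "\<bar>x \<bullet> y\<bar> \<le> (norm x)\<^sup>2 + (norm y)\<^sup>2" for x y :: 'a
    using Cauchy_Schwarz_ineq2[of x y] sum_squares_bound[of "norm x" "norm y"]
      mult_nonneg_nonneg[of "norm x" "norm y"] by simp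
  then show "AE p in X \<Otimes>\<^sub>M Y. norm (fst p \<bullet> snd p) \<le> norm ((norm (fst p))\<^sup>2 + (norm (snd p))\<^sup>2)"
    by simp
qed measurable

lemma integral_inner: "(\<integral>p. fst p \<bullet> snd p \<partial>(X \<Otimes>\<^sub>M Y)) = (\<integral>x. x \<partial>X) \<bullet> (\<integral>y. y \<partial>Y)"
  using integral_fst'[of "\<lambda>p. fst p \<bullet> snd p"] integrable_inner X.integrable_ident Y.integrable_ident
  by simp

lemma integrable_norm_add_squared: "integrable (X \<Otimes>\<^sub>M Y) (\<lambda>p. (norm (fst p + snd p))\<^sup>2)"
  by (simp add: norm_add_squared integrable_norm_squared_comp integrable_inner)

lemma finite_power_indep_sum: "finite_power (indep_sum X Y)"
  unfolding indep_sum_def finite_power_def finite_power_axioms_def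
  using integrable_norm_add_squared
  by (auto intro!: prob_space_distr simp: integrable_distr_eq split_beta')

lemma mean_power_indep_sum:
  assumes "(\<integral>x. x \<partial>X) = 0 \<or> (\<integral>y. y \<partial>Y) = 0"
  shows "mean_power (indep_sum X Y) = mean_power X + mean_power Y"
proof -
  have "mean_power (indep_sum X Y) = (\<integral>p. (norm (fst p + snd p))\<^sup>2 \<partial>(X \<Otimes>\<^sub>M Y))"
    by (simp add: mean_power_def indep_sum_def integral_distr split_beta')
  also have "\<dots> = mean_power X + mean_power Y + 2 * ((\<integral>x. x \<partial>X) \<bullet> (\<integral>y. y \<partial>Y))"
    by (simp add: mean_power_def norm_add_squared integrable_norm_squared_comp integrable_inner
        integral_inner integral_comp_fst[OF X.integrable_norm_squared]
        integral_comp_snd[OF Y.integrable_norm_squared])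
  finally show ?thesis
    using assms by auto
qed

end

lemma distr_pair_sum_density:
  fixes q :: "'a::euclidean_space \<Rightarrow> ennreal"
  assumes [measurable_cong, simp]: "sets X = sets borel"
    and [measurable]: "q \<in> borel_measurable borel"
    and "sigma_finite_measure (density lborel q)"
  shows "distr (X \<Otimes>\<^sub>M density lborel q) (borel \<Otimes>\<^sub>M borel) (\<lambda>(x, w). (x, x + w)) =
    density (X \<Otimes>\<^sub>M lborel) (\<lambda>(x, r). q (r - x))" (is "?L = ?R")
proof (rule measure_eqI)
  interpret q: sigma_finite_measure "density lborel q" by fact
  show "sets ?L = sets ?R"
    by (simp cong: sets_pair_measure_cong)
  fix A assume "A \<in> sets ?L"
  then have [measurable]: "A \<in> sets (borel \<Otimes>\<^sub>M borel)" by simp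
  then have [measurable]: "A \<in> sets (X \<Otimes>\<^sub>M lborel)"
    by (simp cong: sets_pair_measure_cong)
  have "emeasure ?L A = (\<integral>\<^sup>+p. indicator A (fst p, fst p + snd p) \<partial>(X \<Otimes>\<^sub>M density lborel q))"
    by (subst nn_integral_indicator[symmetric], simp, subst nn_integral_distr)
      (auto simp: split_beta')
  also have "\<dots> = (\<integral>\<^sup>+x. \<integral>\<^sup>+w. q w * indicator A (x, x + w) \<partial>lborel \<partial>X)"
    by (subst q.nn_integral_fst[symmetric])
      (auto intro!: nn_integral_cong simp: nn_integral_density)
  also have "\<dots> = (\<integral>\<^sup>+x. \<integral>\<^sup>+r. q (r - x) * indicator A (x, r) \<partial>lborel \<partial>X)"
  proof (rule nn_integral_cong)
    fix x assume [measurable]: "x \<in> space X"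
    show "(\<integral>\<^sup>+w. q w * indicator A (x, x + w) \<partial>lborel) =
        (\<integral>\<^sup>+r. q (r - x) * indicator A (x, r) \<partial>lborel)"
      by (subst nn_integral_lborel_translate[of _ x, symmetric]) auto
  qed
  also have "\<dots> = emeasure ?R A"
    by (simp add: emeasure_density lborel.nn_integral_fst[symmetric] split_beta')
  finally show "emeasure ?L A = emeasure ?R A" .
qed

lemma indep_sum_density:
  fixes q :: "'a::euclidean_space \<Rightarrow> ennreal"
  assumes "sigma_finite_measure X" and [measurable_cong]: "sets X = sets borel"
    and [measurable]: "q \<in> borel_measurable borel"
    and "sigma_finite_measure (density lborel q)"
  shows "indep_sum X (density lborel q) = density lborel (\<lambda>r. \<integral>\<^sup>+x. q (r - x) \<partial>X)" (is "?L = ?R")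
proof (rule measure_eqI)
  interpret X: sigma_finite_measure X by fact
  interpret pair_sigma_finite X lborel ..
  fix A assume "A \<in> sets ?L"
  then have [measurable]: "A \<in> sets borel" by simp
  have "?L = distr (density (X \<Otimes>\<^sub>M lborel) (\<lambda>(x, r). q (r - x))) borel snd"
    unfolding indep_sum_def
    by (subst distr_pair_sum_density[symmetric, OF assms(2-4)], subst distr_distr)
      (auto simp: comp_def split_beta')
  then have "emeasure ?L A = (\<integral>\<^sup>+p. q (snd p - fst p) * indicator A (snd p) \<partial>(X \<Otimes>\<^sub>M lborel))"
    by (simp add: nn_integral_indicator[symmetric] nn_integral_distr nn_integral_density split_beta'
        del: nn_integral_indicator)
  also have "\<dots> = (\<integral>\<^sup>+r. \<integral>\<^sup>+x. q (r - x) * indicator A r \<partial>X \<partial>lborel)"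
    by (subst nn_integral_snd[symmetric]) auto
  also have "\<dots> = emeasure ?R A"
    by (simp add: emeasure_density nn_integral_multc)
  finally show "emeasure ?L A = emeasure ?R A" .
qed simp

subsection \<open>Densities between two Gaussians\<close>

definition gaussian_like :: "('a::real_normed_vector \<Rightarrow> real) \<Rightarrow> bool" where
  "gaussian_like q \<longleftrightarrow>
    (\<exists>c>0. \<exists>B\<ge>0. \<exists>K. \<forall>z. c * exp (- (B * (norm z)\<^sup>2)) \<le> q z \<and> q z \<le> K)"

lemma gaussian_likeI:
  assumes "0 < c" "0 \<le> B" "\<And>z. c * exp (- (B * (norm z)\<^sup>2)) \<le> q z" "\<And>z. q z \<le> K"
  shows "gaussian_like q"
  unfolding gaussian_like_def by (intro exI conjI allI) (rule assms)+

lemma gaussian_likeE: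
  assumes "gaussian_like q"
  obtains c B K where "0 < c" "0 \<le> B" "\<And>z. c * exp (- (B * (norm z)\<^sup>2)) \<le> q z" "\<And>z. q z \<le> K"
  using assms unfolding gaussian_like_def by blast

lemma gaussian_like_pos:
  assumes "gaussian_like q"
  shows "0 < q z"
  using assms
proof (rule gaussian_likeE)
  fix c B K assume "0 < c" and lower: "\<And>z. c * exp (- (B * (norm z)\<^sup>2)) \<le> q z"
  then have "0 < c * exp (- (B * (norm z)\<^sup>2))"
    by simp
  then show "0 < q z"
    using lower by (rule less_le_trans)
qed

lemma gaussian_like_abs_lnE:
  assumes "gaussian_like q"
  obtains A B where "\<And>z. \<bar>ln (q z)\<bar> \<le> A + B * (norm z)\<^sup>2"
proof -
  obtain c B K where c_pos: "0 < c" and B_nonneg: "0 \<le> B"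
    and lower: "\<And>z. c * exp (- (B * (norm z)\<^sup>2)) \<le> q z" and upper: "\<And>z. q z \<le> K"
    using assms by (rule gaussian_likeE) (rule that)
  have "\<bar>ln (q z)\<bar> \<le> (\<bar>ln c\<bar> + \<bar>ln K\<bar>) + B * (norm z)\<^sup>2" for z
  proof -
    have "ln (q z) \<le> ln K"
      using upper[of z] gaussian_like_pos[OF assms, of z] by simp
    moreover have "ln c - B * (norm z)\<^sup>2 \<le> ln (q z)"
      using c_pos ln_mono[OF lower[of z]] by (simp add: ln_mult)
    moreover have "0 \<le> B * (norm z)\<^sup>2"
      using B_nonneg by simp
    ultimately show ?thesis
      by linarith
  qed
  with that show thesis
    by blast
qed

lemma (in finite_power) integrable_log_gaussian_like:
  assumes "gaussian_like q" and [measurable]: "q \<in> borel_measurable borel"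
  shows "integrable M (\<lambda>z. log b (q z))"
proof -
  obtain A B where "\<And>z. \<bar>ln (q z)\<bar> \<le> A + B * (norm z)\<^sup>2"
    using assms(1) by (rule gaussian_like_abs_lnE) (rule that)
  then have "\<bar>ln (q z)\<bar> \<le> norm (A + B * (norm z)\<^sup>2)" for z
    by (metis abs_ge_self order_trans real_norm_def)
  moreover have "integrable M (\<lambda>z. A + B * (norm z)\<^sup>2)"
    using integrable_norm_squared by simp
  ultimately have "integrable M (\<lambda>z. ln (q z))"
    by (intro Bochner_Integration.integrable_bound[where g = "\<lambda>z. ln (q z)"]) auto
  then show ?thesis
    by (simp add: log_def)
qed

definition smoothing :: "'a::real_normed_vector measure \<Rightarrow> ('a \<Rightarrow> real) \<Rightarrow> 'a \<Rightarrow> real" where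
  "smoothing X q r = (\<integral>x. q (r - x) \<partial>X)"

lemma exp_norm_diff_squared_ge:
  fixes x y :: "'a::real_normed_vector"
  assumes "0 \<le> B"
  shows "exp (- (2 * B * (norm x)\<^sup>2)) * exp (- (2 * B * (norm y)\<^sup>2)) \<le>
    exp (- (B * (norm (x - y))\<^sup>2))"
proof -
  have "(norm (x - y))\<^sup>2 \<le> (norm x + norm y)\<^sup>2"
    by (intro power_mono norm_triangle_ineq4) simp
  also have "\<dots> \<le> 2 * (norm x)\<^sup>2 + 2 * (norm y)\<^sup>2"
    using sum_squares_bound[of "norm x" "norm y"] by (simp add: power2_sum)
  finally have "B * (norm (x - y))\<^sup>2 \<le> B * (2 * (norm x)\<^sup>2 + 2 * (norm y)\<^sup>2)"
    using assms by (rule mult_left_mono)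
  then show ?thesis
    by (simp add: exp_add[symmetric] algebra_simps)
qed

context finite_power
begin

lemma borel_measurable_smoothing [measurable]:
  assumes [measurable]: "q \<in> borel_measurable borel"
  shows "smoothing M q \<in> borel_measurable borel"
  unfolding smoothing_def by measurable

lemma integrable_gaussian_like_translate:
  assumes "gaussian_like q" and [measurable]: "q \<in> borel_measurable borel"
  shows "integrable M (\<lambda>x. q (r - x))"
proof -
  obtain K where "\<And>z. q z \<le> K"
    using assms(1) by (rule gaussian_likeE) (rule that)
  then show ?thesis
    using gaussian_like_pos[OF assms(1)]
    by (intro integrable_const_bound[where B = K]) (auto simp: less_imp_le)
qed

lemma nn_integral_smoothing:
  assumes "gaussian_like q" "q \<in> borel_measurable borel"
  shows "(\<integral>\<^sup>+x. q (r - x) \<partial>M) = smoothing M q r"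
  unfolding smoothing_def
  using integrable_gaussian_like_translate[OF assms] gaussian_like_pos[OF assms(1)]
  by (intro nn_integral_eq_integral) (auto simp: less_imp_le)

lemma gaussian_like_smoothing:
  assumes q: "gaussian_like q" "q \<in> borel_measurable borel"
  shows "gaussian_like (smoothing M q)"
proof -
  obtain c B K where c_pos: "0 < c" and B_nonneg: "0 \<le> B"
    and lower: "\<And>z. c * exp (- (B * (norm z)\<^sup>2)) \<le> q z" and upper: "\<And>z. q z \<le> K"
    using q(1) by (rule gaussian_likeE) (rule that)
  let ?e = "\<lambda>x::'a. exp (- (2 * B * (norm x)\<^sup>2))"
  have integrable_exp: "integrable M ?e"
    using B_nonneg by (intro integrable_const_bound[where B = 1]) auto
  show ?thesis
  proof (rule gaussian_likeI)
    have "0 < (\<integral>x. ?e x \<partial>M)"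
      using integral_less_AE_space[of "\<lambda>_. 0" ?e] integrable_exp emeasure_space_1 by simp
    then show "0 < c * (\<integral>x. ?e x \<partial>M)"
      using c_pos by simp
    show "0 \<le> 2 * B"
      using B_nonneg by simp
    fix r
    have "c * (?e r * ?e x) \<le> q (r - x)" for x
      using mult_left_mono[OF exp_norm_diff_squared_ge[OF B_nonneg, of r x], of c] c_pos
        lower[of "r - x"]
      by linarith
    then have "(\<integral>x. c * (?e r * ?e x) \<partial>M) \<le> smoothing M q r"
      unfolding smoothing_def using integrable_exp integrable_gaussian_like_translate[OF q]
      by (intro integral_mono) auto
    then show "c * (\<integral>x. ?e x \<partial>M) * ?e r \<le> smoothing M q r"
      by (simp add: ac_simps)
    show "smoothing M q r \<le> K"
      unfolding smoothing_def using integrable_gaussian_like_translate[OF q] upper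
      by (intro integral_le_const) auto
  qed
qed

end

locale gaussian_like_density = finite_power "density lborel q"
  for q :: "'a::euclidean_space \<Rightarrow> real" +
  assumes borel_measurable_density [measurable]: "q \<in> borel_measurable borel"
    and gaussian_like: "gaussian_like q"
begin

lemma density_pos: "0 < q z"
  using gaussian_like by (rule gaussian_like_pos)

end

locale additive_noise_channel = X: finite_power X + W: gaussian_like_density q
  for X :: "'a::euclidean_space measure" and q :: "'a \<Rightarrow> real"
begin

sublocale finite_power_pair X "density lborel q" ..

lemma indep_sum_eq_density_smoothing:
  "indep_sum X (density lborel q) = density lborel (smoothing X q)"
  using X.nn_integral_smoothing[OF W.gaussian_like]
  by (simp add: indep_sum_density X.sigma_finite_measure_axioms W.sigma_finite_measure_axioms)

sublocale R: gaussian_like_density "smoothing X q"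
  using finite_power_indep_sum X.gaussian_like_smoothing[OF W.gaussian_like]
  by (auto simp: gaussian_like_density_def gaussian_like_density_axioms_def
      indep_sum_eq_density_smoothing)

sublocale product: pair_sigma_finite X lborel ..

definition joint_law :: "('a \<times> 'a) measure" where
  "joint_law = distr (X \<Otimes>\<^sub>M density lborel q) (borel \<Otimes>\<^sub>M borel) (\<lambda>(x, w). (x, x + w))"

lemma prob_space_joint_law: "prob_space joint_law"
  unfolding joint_law_def by (rule prob_space_distr) simp

lemma joint_law_eq_density:
  "joint_law = density (X \<Otimes>\<^sub>M lborel) (\<lambda>p. q (snd p - fst p))"
  unfolding joint_law_def
  by (subst distr_pair_sum_density) (simp_all add: W.sigma_finite_measure_axioms split_beta')

lemma
  assumes "gaussian_like g" and [measurable]: "g \<in> borel_measurable borel"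
  shows integrable_log_noise: "integrable joint_law (\<lambda>p. log b (g (snd p - fst p)))"
    and integral_log_noise:
      "(\<integral>p. log b (g (snd p - fst p)) \<partial>joint_law) = (\<integral>w. log b (g w) \<partial>density lborel q)"
  using integrable_comp_snd[OF W.integrable_log_gaussian_like[OF assms, of b]]
    integral_comp_snd[OF W.integrable_log_gaussian_like[OF assms, of b]]
  by (simp_all add: joint_law_def integrable_distr_eq integral_distr split_beta')

lemma
  assumes "gaussian_like g" and [measurable]: "g \<in> borel_measurable borel"
  shows integrable_log_output: "integrable joint_law (\<lambda>p. log b (g (snd p)))"
    and integral_log_output:
      "(\<integral>p. log b (g (snd p)) \<partial>joint_law) = (\<integral>r. log b (g r) \<partial>density lborel (smoothing X q))"
  using R.integrable_log_gaussian_like[OF assms, of b]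
  by (simp_all add: joint_law_def indep_sum_eq_density_smoothing[symmetric] indep_sum_def
      integrable_distr_eq integral_distr split_beta')

lemma product_output_eq_density:
  "X \<Otimes>\<^sub>M density lborel (smoothing X q) = density (X \<Otimes>\<^sub>M lborel) (\<lambda>p. smoothing X q (snd p))"
proof -
  have "density X (\<lambda>_. 1) \<Otimes>\<^sub>M density lborel (smoothing X q) =
      density (X \<Otimes>\<^sub>M lborel) (\<lambda>(x, r). 1 * ennreal (smoothing X q r))"
    by (intro pair_measure_density R.sigma_finite_measure_axioms lborel.sigma_finite_measure_axioms)
      simp_all
  then show ?thesis
    by (simp add: density_1 split_beta')
qed

end

subsection \<open>Mutual information over an additive noise channel\<close>

lemma (in sigma_finite_measure) Gibbs_inequality:
  fixes p k :: "'a \<Rightarrow> real"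
  assumes b: "1 < b"
    and [measurable]: "p \<in> borel_measurable M" and p: "\<And>x. 0 < p x" "prob_space (density M p)"
    and [measurable]: "k \<in> borel_measurable M" and k: "\<And>x. 0 < k x" "prob_space (density M k)"
    and log_integrable: "integrable (density M p) (\<lambda>x. log b (p x))"
      "integrable (density M p) (\<lambda>x. log b (k x))"
  shows "(\<integral>x. log b (k x) \<partial>density M p) \<le> (\<integral>x. log b (p x) \<partial>density M p)"
proof -
  have log_ratio: "log b (p x / k x) = log b (p x) - log b (k x)" for x
    using p(1) k(1) by (intro log_divide_pos)
  have nonneg: "AE x in M. 0 \<le> p x" "AE x in M. 0 \<le> k x" "AE x in M. k x = 0 \<longrightarrow> p x = 0"
    using p(1) k(1) by (auto simp: less_imp_le less_imp_neq[symmetric])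
  have "integrable (density M p) (\<lambda>x. log b (p x / k x))"
    unfolding log_ratio using log_integrable by (rule Bochner_Integration.integrable_diff)
  then have "0 \<le> KL_divergence b (density M k) (density M p)"
    using b p k nonneg
    by (intro KL_density_density_nonneg) (simp_all add: integrable_real_density)
  also have "\<dots> = (\<integral>x. p x * log b (p x / k x) \<partial>M)"
    using b nonneg by (intro KL_density_density) simp_all
  also have "\<dots> = (\<integral>x. log b (p x / k x) \<partial>density M p)"
    using nonneg by (simp add: integral_real_density)
  also have "\<dots> = (\<integral>x. log b (p x) \<partial>density M p) - (\<integral>x. log b (k x) \<partial>density M p)"
    unfolding log_ratio using log_integrable by (rule Bochner_Integration.integral_diff)
  finally show ?thesis
    by simp
qed

definition differential_entropy :: "real \<Rightarrow> ('a::euclidean_space \<Rightarrow> real) \<Rightarrow> real" where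
  "differential_entropy b q = - (\<integral>x. log b (q x) \<partial>density lborel q)"

lemma differential_entropy_le_cross_entropy:
  assumes "1 < b" "gaussian_like_density q" "gaussian_like_density g"
  shows "differential_entropy b q \<le> - (\<integral>x. log b (g x) \<partial>density lborel q)"
proof -
  interpret q: gaussian_like_density q by fact
  interpret g: gaussian_like_density g by fact
  show ?thesis
    unfolding differential_entropy_def
    using \<open>1 < b\<close> q.density_pos g.density_pos q.prob_space_axioms g.prob_space_axioms
      q.integrable_log_gaussian_like[OF q.gaussian_like]
      q.integrable_log_gaussian_like[OF g.gaussian_like]
    by (simp add: lborel.Gibbs_inequality)
qed

definition additive_noise_information ::
  "real \<Rightarrow> 'a::euclidean_space measure \<Rightarrow> 'a measure \<Rightarrow> real" where
  "additive_noise_information b X W =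
    prob_space.mutual_information (X \<Otimes>\<^sub>M W) b borel borel fst (\<lambda>(x, w). x + w)"

lemma additive_noise_information_distr:
  fixes X :: "'a::euclidean_space measure"
  assumes "prob_space X" "prob_space N" and [measurable_cong]: "sets X = sets borel"
    and [measurable]: "w \<in> borel_measurable N"
  shows "additive_noise_information b X (distr N borel w) =
    prob_space.mutual_information (X \<Otimes>\<^sub>M N) b borel borel fst (\<lambda>(x, y). x + w y)"
proof -
  interpret X: prob_space X by fact
  interpret N: prob_space N by fact
  interpret W: prob_space "distr N borel w" by (rule N.prob_space_distr) fact
  interpret pair_prob_space X N ..
  have "X \<Otimes>\<^sub>M distr N borel w = distr X X (\<lambda>x. x) \<Otimes>\<^sub>M distr N borel w"
    by simp
  also have "\<dots> = distr (X \<Otimes>\<^sub>M N) (X \<Otimes>\<^sub>M borel) (\<lambda>(x, y). (x, w y))"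
    by (intro pair_measure_distr W.sigma_finite_measure_axioms) simp_all
  finally show ?thesis
    by (simp add: additive_noise_information_def mutual_information_distr split_beta')
qed

context additive_noise_channel
begin

lemma additive_noise_information_eq_KL:
  "additive_noise_information b X (density lborel q) =
    KL_divergence b (density (X \<Otimes>\<^sub>M lborel) (\<lambda>p. smoothing X q (snd p))) joint_law"
proof -
  let ?W = "density lborel q"
  have "distr (X \<Otimes>\<^sub>M ?W) borel fst = distr (X \<Otimes>\<^sub>M ?W) X fst"
    by (rule distr_cong) simp_all
  then have "distr (X \<Otimes>\<^sub>M ?W) borel fst = X"
    by (simp add: W.distr_pair_fst)
  moreover have "distr (X \<Otimes>\<^sub>M ?W) borel (\<lambda>(x, w). x + w) = density lborel (smoothing X q)"
    using indep_sum_eq_density_smoothing by (simp add: indep_sum_def)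
  ultimately show ?thesis
    by (simp add: additive_noise_information_def mutual_information_def product_output_eq_density
        joint_law_def split_beta')
qed

lemma additive_noise_information_eq_entropy_diff:
  assumes "1 < b"
  shows "additive_noise_information b X (density lborel q) =
    differential_entropy b (smoothing X q) - differential_entropy b q"
proof -
  let ?f = "smoothing X q"
  have "additive_noise_information b X (density lborel q) =
      (\<integral>p. q (snd p - fst p) * log b (q (snd p - fst p) / ?f (snd p)) \<partial>(X \<Otimes>\<^sub>M lborel))"
    unfolding additive_noise_information_eq_KL joint_law_eq_density
    using assms W.density_pos R.density_pos
    by (intro product.KL_density_density) (auto simp: less_imp_le less_imp_neq[symmetric])
  also have "\<dots> = (\<integral>p. log b (q (snd p - fst p) / ?f (snd p)) \<partial>joint_law)"
    unfolding joint_law_eq_density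
    using W.density_pos by (subst integral_real_density) (auto simp: less_imp_le)
  also have "\<dots> = (\<integral>p. log b (q (snd p - fst p)) - log b (?f (snd p)) \<partial>joint_law)"
    using W.density_pos R.density_pos by (simp add: log_divide_pos)
  also have "\<dots> = (\<integral>w. log b (q w) \<partial>density lborel q) - (\<integral>r. log b (?f r) \<partial>density lborel ?f)"
    by (simp add: integrable_log_noise integral_log_noise W.gaussian_like
        integrable_log_output integral_log_output R.gaussian_like)
  finally show ?thesis
    by (simp add: differential_entropy_def)
qed

lemma expectation_log_density_le:
  fixes k :: "'a \<times> 'a \<Rightarrow> real"
  assumes "1 < b" and [measurable]: "k \<in> borel_measurable (borel \<Otimes>\<^sub>M borel)"
    and "\<And>p. 0 < k p" "prob_space (density (X \<Otimes>\<^sub>M lborel) k)"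
    and "integrable joint_law (\<lambda>p. log b (k p))"
  shows "(\<integral>p. log b (k p) \<partial>joint_law) \<le> - differential_entropy b q"
proof -
  have "(\<integral>p. log b (k p) \<partial>joint_law) \<le> (\<integral>p. log b (q (snd p - fst p)) \<partial>joint_law)"
    using assms W.density_pos prob_space_joint_law integrable_log_noise[OF W.gaussian_like]
    unfolding joint_law_eq_density by (intro product.Gibbs_inequality) simp_all
  then show ?thesis
    by (simp add: integral_log_noise W.gaussian_like differential_entropy_def)
qed

lemma additive_noise_information_nonneg:
  assumes "1 < b"
  shows "0 \<le> additive_noise_information b X (density lborel q)"
proof -
  interpret XR: pair_prob_space X "density lborel (smoothing X q)" ..
  have "(\<integral>p. log b (smoothing X q (snd p)) \<partial>joint_law) \<le> - differential_entropy b q"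
    using assms R.density_pos XR.prob_space_axioms integrable_log_output[OF R.gaussian_like]
    by (intro expectation_log_density_le) (simp_all add: product_output_eq_density)
  then show ?thesis
    by (simp add: additive_noise_information_eq_entropy_diff[OF assms] integral_log_output
        R.gaussian_like differential_entropy_def)
qed

text \<open>
  By Bayes' rule, \<open>g (r - x) / smoothing X g r\<close> is the density of the input given the output \<open>r\<close>
  over the channel with noise density \<open>g\<close>; the output law is that of the channel with noise \<open>q\<close>.
\<close>

lemma prob_space_output_posterior:
  assumes "gaussian_like_density g"
  shows "prob_space (density (X \<Otimes>\<^sub>M lborel)
    (\<lambda>p. smoothing X q (snd p) * g (snd p - fst p) / smoothing X g (snd p)))"
    (is "prob_space (density _ ?k)")
proof (rule prob_spaceI)
  interpret G: additive_noise_channel X g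
    using assms X.finite_power_axioms by (simp add: additive_noise_channel_def)
  let ?f = "smoothing X q" and ?h = "smoothing X g"
  let ?P = "X \<Otimes>\<^sub>M (lborel :: 'a measure)"
  have "emeasure (density ?P ?k) (space ?P) = (\<integral>\<^sup>+p. ?k p * indicator (space ?P) p \<partial>?P)"
    by (rule emeasure_density) measurable
  also have "\<dots> = (\<integral>\<^sup>+p. ?k p \<partial>?P)"
    by (simp cong: nn_integral_cong)
  also have "\<dots> =
      (\<integral>\<^sup>+r. \<integral>\<^sup>+x. ennreal (?f r / ?h r) * ennreal (g (r - x)) \<partial>X \<partial>lborel)"
    using R.density_pos G.W.density_pos G.R.density_pos
    by (subst product.nn_integral_snd[symmetric])
      (auto simp: ennreal_mult[symmetric] less_imp_le intro!: nn_integral_cong)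
  also have "\<dots> = (\<integral>\<^sup>+r. ennreal (?f r) \<partial>lborel)"
    using R.density_pos G.R.density_pos
    by (intro nn_integral_cong)
      (simp add: nn_integral_cmult X.nn_integral_smoothing[OF G.W.gaussian_like]
        ennreal_mult[symmetric] less_imp_le less_imp_neq[symmetric])
  also have "\<dots> = 1"
    using R.emeasure_space_1 by (simp add: emeasure_density)
  finally show "emeasure (density ?P ?k) (space (density ?P ?k)) = 1"
    by simp
qed

lemma additive_noise_information_ge:
  assumes "1 < b" "gaussian_like_density g"
  shows "(\<integral>w. log b (g w) \<partial>density lborel q) -
      (\<integral>r. log b (smoothing X g r) \<partial>density lborel (smoothing X q)) \<le>
    additive_noise_information b X (density lborel q)"
proof -
  interpret G: additive_noise_channel X g
    using assms X.finite_power_axioms by (simp add: additive_noise_channel_def)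
  let ?f = "smoothing X q" and ?h = "smoothing X g"
  have log_posterior: "log b (?f r * g w / ?h r) = log b (?f r) + log b (g w) - log b (?h r)"
    for r w
    using R.density_pos G.W.density_pos G.R.density_pos by (simp add: log_divide_pos log_mult_pos)
  note log_integrals = integrable_log_output integral_log_output integrable_log_noise
    integral_log_noise R.gaussian_like G.R.gaussian_like G.W.gaussian_like
  have "(\<integral>p. log b (?f (snd p) * g (snd p - fst p) / ?h (snd p)) \<partial>joint_law) \<le>
      - differential_entropy b q"
    using assms R.density_pos G.W.density_pos G.R.density_pos
    by (intro expectation_log_density_le prob_space_output_posterior)
      (simp_all add: log_posterior log_integrals)
  then show ?thesis
    by (simp add: log_posterior log_integrals differential_entropy_def
        additive_noise_information_eq_entropy_diff[OF assms(1)])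
qed

end

subsection \<open>The circularly symmetric Gaussian law\<close>

lemma measurable_Complex [measurable]:
  "(\<lambda>(x, y). Complex x y) \<in> borel \<Otimes>\<^sub>M borel \<rightarrow>\<^sub>M borel"
  unfolding Complex_eq by measurable

lemma distr_lborel_Complex: "distr (lborel \<Otimes>\<^sub>M lborel) borel (\<lambda>(x, y). Complex x y) = lborel"
proof (rule lborel_eqI[symmetric])
  fix l u :: complex
  assume "\<And>b. b \<in> Basis \<Longrightarrow> l \<bullet> b \<le> u \<bullet> b"
  from this[of 1] this[of "\<i>"] have Re_Im_le: "Re l \<le> Re u" "Im l \<le> Im u"
    by (auto simp: Basis_complex_def)
  have vimage_box: "(\<lambda>(x, y). Complex x y) -` box l u \<inter> space (lborel \<Otimes>\<^sub>M lborel) =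
      {Re l<..<Re u} \<times> {Im l<..<Im u}"
    by (auto simp: box_def Basis_complex_def space_pair_measure)
  show "emeasure (distr (lborel \<Otimes>\<^sub>M lborel) borel (\<lambda>(x, y). Complex x y)) (box l u) =
      (\<Prod>b\<in>Basis. (u - l) \<bullet> b)"
    using Re_Im_le
    by (subst emeasure_distr)
       (auto simp: vimage_box lborel.emeasure_pair_measure_Times Basis_complex_def ennreal_mult)
qed simp

lemma nn_integral_lborel_complex:
  assumes [measurable]: "f \<in> borel_measurable borel"
  shows "(\<integral>\<^sup>+z. f z \<partial>lborel) = (\<integral>\<^sup>+x. \<integral>\<^sup>+y. f (Complex x y) \<partial>lborel \<partial>lborel)"
proof -
  have [measurable]: "(\<lambda>x. f (Complex (fst x) (snd x))) \<in> borel_measurable (lborel \<Otimes>\<^sub>M lborel)"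
    using measurable_compose[OF measurable_Complex assms] by (simp add: case_prod_beta)
  have "(\<integral>\<^sup>+z. f z \<partial>lborel) = (\<integral>\<^sup>+x. f (Complex (fst x) (snd x)) \<partial>(lborel \<Otimes>\<^sub>M lborel))"
    by (subst distr_lborel_Complex[symmetric], subst nn_integral_distr) (auto simp: case_prod_beta)
  then show ?thesis
    by (subst (asm) lborel.nn_integral_fst[symmetric]) auto
qed

definition gaussian_density :: "real \<Rightarrow> complex \<Rightarrow> real" where
  "gaussian_density P z = exp (- ((cmod z)\<^sup>2 / P)) / (pi * P)"

lemma borel_measurable_gaussian_density [measurable]: "gaussian_density P \<in> borel_measurable borel"
  unfolding gaussian_density_def by measurable

lemma gaussian_density_pos: "P > 0 \<Longrightarrow> 0 < gaussian_density P z"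
  by (simp add: gaussian_density_def)

lemma gaussian_density_unit_mult:
  "cmod u = 1 \<Longrightarrow> gaussian_density P (u * z) = gaussian_density P z"
  by (simp add: gaussian_density_def norm_mult)

lemma gaussian_density_Complex:
  assumes "P > 0"
  shows "gaussian_density P (Complex x y) =
    normal_density 0 (sqrt (P / 2)) x * normal_density 0 (sqrt (P / 2)) y"
proof -
  have "exp (- ((x\<^sup>2 + y\<^sup>2) / P)) = exp (- (x\<^sup>2 / P)) * exp (- (y\<^sup>2 / P))"
    by (simp add: exp_add[symmetric] add_divide_distrib)
  with assms show ?thesis
    by (simp add: gaussian_density_def normal_density_def cmod_power2 field_simps)
qed

lemma complex_gaussian_eq_density:
  assumes "P > 0"
  shows "complex_gaussian P = density lborel (gaussian_density P)"
proof -
  let ?n = "\<lambda>x. ennreal (normal_density 0 (sqrt (P / 2)) x)"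
  interpret n: prob_space "density lborel ?n"
    by (rule prob_space_normal_density) (use assms in simp)
  have "complex_gaussian P =
      distr (density (lborel \<Otimes>\<^sub>M lborel) (\<lambda>(x, y). ?n x * ?n y)) borel (\<lambda>(x, y). Complex x y)"
    using assms n.sigma_finite_measure_axioms
    by (simp add: complex_gaussian_def pair_measure_density lborel.sigma_finite_measure_axioms)
  also have "(\<lambda>(x, y). ?n x * ?n y) =
      (\<lambda>p. ennreal (gaussian_density P (case p of (x, y) \<Rightarrow> Complex x y)))"
    using assms by (auto simp: gaussian_density_Complex ennreal_mult fun_eq_iff)
  also have "distr (density (lborel \<Otimes>\<^sub>M lborel) \<dots>) borel (\<lambda>(x, y). Complex x y) =
      density (distr (lborel \<Otimes>\<^sub>M lborel) borel (\<lambda>(x, y). Complex x y)) (gaussian_density P)"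
    by (rule density_distr[symmetric]) auto
  finally show ?thesis
    by (simp add: distr_lborel_Complex)
qed

lemma sets_complex_gaussian [measurable_cong, simp]: "sets (complex_gaussian P) = sets borel"
  by (simp add: complex_gaussian_def)

lemma nn_integral_gaussian_density_convolution:
  assumes "P > 0" "Q > 0"
  shows "(\<integral>\<^sup>+w. ennreal (gaussian_density P w) * ennreal (gaussian_density Q (z - w)) \<partial>lborel) =
    gaussian_density (P + Q) z"
proof -
  let ?n = "\<lambda>P. normal_density 0 (sqrt (P / 2))"
  have normal_convolution: "(\<integral>\<^sup>+y. ennreal (?n Q (x - y) * ?n P y) \<partial>lborel) = ?n (P + Q) x" for x
    using conv_normal_density_zero_mean[of "sqrt (Q / 2)" "sqrt (P / 2)"] assms
    by (simp add: fun_eq_iff add_divide_distrib[symmetric] add.commute)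
  have "(\<integral>\<^sup>+w. ennreal (gaussian_density P w) * ennreal (gaussian_density Q (z - w)) \<partial>lborel) =
      (\<integral>\<^sup>+x. \<integral>\<^sup>+y. ennreal (?n Q (Re z - x) * ?n P x) * ennreal (?n Q (Im z - y) * ?n P y)
        \<partial>lborel \<partial>lborel)"
  proof (subst nn_integral_lborel_complex, measurable, intro nn_integral_cong)
    fix x y
    have "z - Complex x y = Complex (Re z - x) (Im z - y)"
      by (simp add: complex_eq_iff)
    then show "ennreal (gaussian_density P (Complex x y)) *
        ennreal (gaussian_density Q (z - Complex x y)) =
        ennreal (?n Q (Re z - x) * ?n P x) * ennreal (?n Q (Im z - y) * ?n P y)"
      using assms by (simp add: gaussian_density_Complex ennreal_mult[symmetric] ac_simps)
  qed
  also have "\<dots> = ennreal (?n (P + Q) (Re z)) * ennreal (?n (P + Q) (Im z))"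
    by (simp add: nn_integral_cmult nn_integral_multc normal_convolution)
  also have "\<dots> = gaussian_density (P + Q) z"
    using assms gaussian_density_Complex[of "P + Q" "Re z" "Im z"] by (simp add: ennreal_mult)
  finally show ?thesis .
qed

lemma
  assumes "0 < \<sigma>"
  shows finite_power_normal: "finite_power (density lborel (normal_density 0 \<sigma>))"
    and mean_power_normal: "mean_power (density lborel (normal_density 0 \<sigma>)) = \<sigma>\<^sup>2"
  using assms prob_space_normal_density[OF assms, of 0] integrable_normal_moment[OF assms, of 0 2]
    integral_normal_moment_even[OF assms, of 0 1]
  by (simp_all add: finite_power_def finite_power_axioms_def mean_power_def
      integrable_real_density integral_real_density)

lemma
  assumes "P \<ge> 0"
  shows finite_power_complex_gaussian: "finite_power (complex_gaussian P)"
    and mean_power_complex_gaussian: "mean_power (complex_gaussian P) = P"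
proof -
  have "finite_power (complex_gaussian P) \<and> mean_power (complex_gaussian P) = P"
  proof (cases "P = 0")
    case True
    then show ?thesis
      by (simp add: complex_gaussian_def finite_power_def finite_power_axioms_def mean_power_def
          prob_space_return integral_return integrable_iff_bounded nn_integral_return)
  next
    case False
    define n where "n = density lborel (normal_density 0 (sqrt (P / 2)))"
    interpret n: finite_power n
      unfolding n_def by (rule finite_power_normal) (use assms False in simp)
    interpret finite_power_pair n n ..
    have gaussian: "complex_gaussian P = distr (n \<Otimes>\<^sub>M n) borel (\<lambda>(x, y). Complex x y)"
      using False by (simp add: complex_gaussian_def n_def)
    have "(\<integral>x. x\<^sup>2 \<partial>n) = P / 2"
      using mean_power_normal[of "sqrt (P / 2)"] assms False by (simp add: n_def mean_power_def)
    then have "mean_power (complex_gaussian P) = P"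
      using integrable_norm_squared_comp integral_comp_fst[OF n.integrable_norm_squared]
        integral_comp_snd[OF n.integrable_norm_squared]
      by (simp add: gaussian mean_power_def integral_distr split_beta' cmod_power2)
    moreover have "finite_power (complex_gaussian P)"
      using integrable_norm_squared_comp
      by (auto simp: gaussian finite_power_def finite_power_axioms_def integrable_distr_eq
          split_beta' cmod_power2 intro!: prob_space_distr)
    ultimately show ?thesis
      by simp
  qed
  then show "finite_power (complex_gaussian P)" "mean_power (complex_gaussian P) = P"
    by simp_all
qed

lemma integral_complex_gaussian:
  assumes "P \<ge> 0"
  shows "(\<integral>z. z \<partial>complex_gaussian P) = 0"
proof (cases "P = 0")
  case True
  then show ?thesis
    by (simp add: complex_gaussian_def integral_return)
next
  case False
  with assms have "P > 0"
    by simp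
  then have "(\<integral>z. z \<partial>complex_gaussian P) = (\<integral>z. gaussian_density P z *\<^sub>R z \<partial>lborel)"
    by (simp add: complex_gaussian_eq_density integral_density less_imp_le[OF gaussian_density_pos])
  also have "\<dots> = 0"
    by (rule integral_lborel_odd) (simp_all add: gaussian_density_def)
  finally show ?thesis .
qed

lemma gaussian_like_density_gaussian:
  assumes "P > 0"
  shows "gaussian_like_density (gaussian_density P)"
proof -
  have "gaussian_like (gaussian_density P)"
    by (rule gaussian_likeI[of "1 / (pi * P)" "1 / P" _ "1 / (pi * P)"])
      (use assms in \<open>simp_all add: gaussian_density_def divide_right_mono\<close>)
  then show ?thesis
    using finite_power_complex_gaussian[of P] assms
    by (simp add: gaussian_like_density_def gaussian_like_density_axioms_def
        complex_gaussian_eq_density)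
qed

lemma smoothing_gaussian:
  assumes "P \<ge> 0" "Q > 0"
  shows "smoothing (complex_gaussian P) (gaussian_density Q) = gaussian_density (P + Q)"
proof
  fix z
  interpret additive_noise_channel "complex_gaussian P" "gaussian_density Q"
    using assms
    by (simp add: additive_noise_channel_def finite_power_complex_gaussian
        gaussian_like_density_gaussian)
  show "smoothing (complex_gaussian P) (gaussian_density Q) z = gaussian_density (P + Q) z"
  proof (cases "P = 0")
    case True
    then show ?thesis
      by (simp add: smoothing_def complex_gaussian_def integral_return)
  next
    case False
    then have "P > 0"
      using assms by simp
    have "ennreal (smoothing (complex_gaussian P) (gaussian_density Q) z) =
        (\<integral>\<^sup>+w. gaussian_density Q (z - w) \<partial>complex_gaussian P)"
      by (rule X.nn_integral_smoothing[OF W.gaussian_like W.borel_measurable_density, symmetric])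
    also have "\<dots> = gaussian_density (P + Q) z"
      using nn_integral_gaussian_density_convolution[OF \<open>P > 0\<close> \<open>Q > 0\<close>]
      by (simp add: complex_gaussian_eq_density[OF \<open>P > 0\<close>] nn_integral_density)
    finally show ?thesis
      using R.density_pos[of z] gaussian_density_pos[of "P + Q" z] assms by (simp add: less_imp_le)
  qed
qed

lemma integral_log_gaussian_density:
  assumes "P > 0" "finite_power M"
  shows "(\<integral>z. log b (gaussian_density P z) \<partial>M) = - log b (pi * P) - mean_power M / (P * ln b)"
proof -
  interpret finite_power M by fact
  have "log b (gaussian_density P z) = - log b (pi * P) - (cmod z)\<^sup>2 / (P * ln b)" for z
    using \<open>P > 0\<close> by (simp add: gaussian_density_def log_divide_pos)
  then show ?thesis
    using integrable_norm_squared by (simp add: mean_power_def prob_space)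
qed

lemma differential_entropy_gaussian:
  assumes "P > 0"
  shows "differential_entropy b (gaussian_density P) = log b (pi * P) + 1 / ln b"
  using integral_log_gaussian_density[OF assms finite_power_complex_gaussian, of P b] assms
  by (simp add: differential_entropy_def complex_gaussian_eq_density[symmetric]
      mean_power_complex_gaussian)

lemma differential_entropy_le_gaussian:
  fixes q :: "complex \<Rightarrow> real"
  assumes "1 < b" "P > 0" and q: "gaussian_like_density q" "mean_power (density lborel q) \<le> P"
  shows "differential_entropy b q \<le> differential_entropy b (gaussian_density P)"
proof -
  have "differential_entropy b q \<le> - (\<integral>z. log b (gaussian_density P z) \<partial>density lborel q)"
    using assms by (intro differential_entropy_le_cross_entropy gaussian_like_density_gaussian)
  also have "\<dots> = log b (pi * P) + mean_power (density lborel q) / (P * ln b)"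
    using integral_log_gaussian_density[OF \<open>P > 0\<close>, of "density lborel q"] q(1)
    by (simp add: gaussian_like_density_def)
  also have "mean_power (density lborel q) / (P * ln b) \<le> P / (P * ln b)"
    using assms by (intro divide_right_mono) simp_all
  finally show ?thesis
    using \<open>P > 0\<close> by (simp add: differential_entropy_gaussian)
qed

lemma log_one_plus_snr:
  assumes "0 \<le> P" "0 < Q"
  shows "log b (1 + P / Q) = log b (pi * (P + Q)) - log b (pi * Q)"
proof -
  have "1 + P / Q = (P + Q) / Q"
    using assms by (simp add: field_simps)
  then show ?thesis
    using assms by (simp add: log_divide_pos log_mult_pos)
qed

lemma gaussian_noise_information_le:
  assumes "1 < b" "Q > 0" and X: "finite_power X" "mean_power X \<le> P"
  shows "additive_noise_information b X (complex_gaussian Q) \<le> log b (1 + P / Q)"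
proof -
  interpret additive_noise_channel X "gaussian_density Q"
    using X \<open>Q > 0\<close> by (simp add: additive_noise_channel_def gaussian_like_density_gaussian)
  have "0 \<le> P"
    using mean_power_nonneg[of X] X(2) by simp
  have noise: "density lborel (gaussian_density Q) = complex_gaussian Q"
    using \<open>Q > 0\<close> by (simp add: complex_gaussian_eq_density)
  have "mean_power (density lborel (smoothing X (gaussian_density Q))) = mean_power X + Q"
    using mean_power_indep_sum \<open>Q > 0\<close>
    by (simp add: noise integral_complex_gaussian mean_power_complex_gaussian
        flip: indep_sum_eq_density_smoothing)
  then have "differential_entropy b (smoothing X (gaussian_density Q)) \<le>
      differential_entropy b (gaussian_density (P + Q))"
    using assms \<open>0 \<le> P\<close> R.gaussian_like_density_axioms
    by (intro differential_entropy_le_gaussian) simp_all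
  then show ?thesis
    using additive_noise_information_eq_entropy_diff[OF \<open>1 < b\<close>] \<open>0 \<le> P\<close> \<open>Q > 0\<close>
    by (simp add: noise differential_entropy_gaussian log_one_plus_snr)
qed

lemma gaussian_signal_information_ge:
  assumes "1 < b" "0 \<le> P" "Q > 0"
    and q: "gaussian_like_density q" "mean_power (density lborel q) \<le> Q"
  shows "log b (1 + P / Q) \<le> additive_noise_information b (complex_gaussian P) (density lborel q)"
proof -
  interpret additive_noise_channel "complex_gaussian P" q
    using q \<open>0 \<le> P\<close> by (simp add: additive_noise_channel_def finite_power_complex_gaussian)
  define N where "N = mean_power (density lborel q)"
  have output_power: "mean_power (density lborel (smoothing (complex_gaussian P) q)) = P + N"
    using mean_power_indep_sum \<open>0 \<le> P\<close>
    by (simp add: N_def integral_complex_gaussian mean_power_complex_gaussian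
        flip: indep_sum_eq_density_smoothing)
  have "N / Q \<le> (P + N) / (P + Q)"
    using mult_left_mono[of N Q P] q(2) assms by (simp add: N_def field_simps)
  then have "N / (Q * ln b) \<le> (P + N) / ((P + Q) * ln b)"
    using \<open>1 < b\<close> divide_right_mono[of _ _ "ln b"] by fastforce
  then have "log b (1 + P / Q) \<le>
      (\<integral>w. log b (gaussian_density Q w) \<partial>density lborel q) -
      (\<integral>r. log b (gaussian_density (P + Q) r) \<partial>density lborel (smoothing (complex_gaussian P) q))"
    using assms output_power W.finite_power_axioms R.finite_power_axioms
    by (simp add: integral_log_gaussian_density log_one_plus_snr N_def)
  also have "\<dots> \<le> additive_noise_information b (complex_gaussian P) (density lborel q)"
    using additive_noise_information_ge[OF \<open>1 < b\<close> gaussian_like_density_gaussian[OF \<open>Q > 0\<close>]] assms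
    by (simp add: smoothing_gaussian)
  finally show ?thesis .
qed

subsection \<open>Saddle points\<close>

lemma
  fixes \<phi> :: "'a \<Rightarrow> 'b \<Rightarrow> 'c::conditionally_complete_lattice"
  assumes saddle: "x\<^sub>0 \<in> A" "y\<^sub>0 \<in> B"
      "\<And>x. x \<in> A \<Longrightarrow> \<phi> x y\<^sub>0 \<le> v" "\<And>y. y \<in> B \<Longrightarrow> v \<le> \<phi> x\<^sub>0 y"
    and bdd: "\<And>x. x \<in> A \<Longrightarrow> bdd_below (\<phi> x ` B)"
  shows saddle_point_INF: "(INF y\<in>B. \<phi> x\<^sub>0 y) = v"
    and saddle_point_SUP_INF: "(SUP x\<in>A. INF y\<in>B. \<phi> x y) = v"
proof -
  have INF_le: "(INF y\<in>B. \<phi> x y) \<le> v" if "x \<in> A" for x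
    using cINF_lower2[OF bdd[OF that] \<open>y\<^sub>0 \<in> B\<close>] saddle(3)[OF that] .
  show INF_eq: "(INF y\<in>B. \<phi> x\<^sub>0 y) = v"
    using saddle by (intro antisym INF_le cINF_greatest) auto
  have "bdd_above ((\<lambda>x. INF y\<in>B. \<phi> x y) ` A)"
    by (rule bdd_aboveI2[OF INF_le])
  from cSUP_upper[OF \<open>x\<^sub>0 \<in> A\<close> this] have "v \<le> (SUP x\<in>A. INF y\<in>B. \<phi> x y)"
    by (simp only: INF_eq)
  moreover have "(SUP x\<in>A. INF y\<in>B. \<phi> x y) \<le> v"
    using saddle(1) INF_le by (intro cSUP_least) auto
  ultimately show "(SUP x\<in>A. INF y\<in>B. \<phi> x y) = v"
    by (intro antisym)
qed

subsection \<open>The jamming channel\<close>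

lemma in_power_dists_iff: "F \<in> power_dists P \<longleftrightarrow> finite_power F \<and> mean_power F \<le> P"
  by (auto simp: power_dists_def finite_power_def finite_power_axioms_def mean_power_def)

definition randomly_rotated :: "complex measure \<Rightarrow> complex measure \<Rightarrow> complex measure" where
  "randomly_rotated U F = distr (F \<Otimes>\<^sub>M U) borel (\<lambda>(z, u). u * z)"

lemma sets_randomly_rotated [measurable_cong, simp]: "sets (randomly_rotated U F) = sets borel"
  by (simp add: randomly_rotated_def)

locale phase_law = prob_space U for U :: "complex measure" +
  assumes sets_eq_borel [measurable_cong, simp]: "sets U = sets borel"
    and AE_unit: "AE u in U. cmod u = 1"

locale randomly_rotated_law = U: phase_law U + F: finite_power F for U F :: "complex measure"
begin

sublocale pair_prob_space F U ..

lemma AE_norm_rotated: "AE p in F \<Otimes>\<^sub>M U. (cmod (snd p * fst p))\<^sup>2 = (cmod (fst p))\<^sup>2"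
proof -
  have "AE p in F \<Otimes>\<^sub>M U. cmod (snd p) = 1"
    using AE_distrD[OF measurable_snd, of "\<lambda>u. cmod u = 1" F U] U.AE_unit
    unfolding distr_pair_snd by blast
  then show ?thesis
    by eventually_elim (simp add: norm_mult)
qed

lemma finite_power_randomly_rotated: "finite_power (randomly_rotated U F)"
proof -
  have "integrable (F \<Otimes>\<^sub>M U) (\<lambda>p. (cmod (snd p * fst p))\<^sup>2)"
    by (rule integrable_cong_AE[THEN iffD2,
          OF _ _ AE_norm_rotated integrable_comp_fst[OF F.integrable_norm_squared]]) measurable
  then show ?thesis
    by (auto simp: randomly_rotated_def finite_power_def finite_power_axioms_def
        integrable_distr_eq split_beta' intro!: prob_space_distr)
qed

lemma mean_power_randomly_rotated: "mean_power (randomly_rotated U F) = mean_power F"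
proof -
  have "mean_power (randomly_rotated U F) = (\<integral>p. (cmod (snd p * fst p))\<^sup>2 \<partial>(F \<Otimes>\<^sub>M U))"
    by (simp add: mean_power_def randomly_rotated_def integral_distr split_beta')
  also have "\<dots> = (\<integral>p. (cmod (fst p))\<^sup>2 \<partial>(F \<Otimes>\<^sub>M U))"
    using AE_norm_rotated by (intro integral_cong_AE) simp_all
  finally show ?thesis
    by (simp add: mean_power_def integral_comp_fst[OF F.integrable_norm_squared])
qed

lemma distr_rotated_plus_noise:
  assumes "prob_space N" and [measurable_cong]: "sets N = sets borel"
  shows "distr (F \<Otimes>\<^sub>M (U \<Otimes>\<^sub>M N)) borel (\<lambda>(z, u, n). u * z + n) = indep_sum (randomly_rotated U F) N"
proof -
  interpret N: prob_space N by fact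
  have "distr (F \<Otimes>\<^sub>M (U \<Otimes>\<^sub>M N)) borel (\<lambda>(z, u, n). u * z + n) =
      distr ((F \<Otimes>\<^sub>M U) \<Otimes>\<^sub>M N) borel (\<lambda>((z, u), n). u * z + n)"
    by (subst distr_pair_assoc[symmetric],
        simp_all add: F.sigma_finite_measure_axioms U.sigma_finite_measure_axioms
          N.sigma_finite_measure_axioms distr_distr comp_def split_beta')
  also have "\<dots> = indep_sum (distr (F \<Otimes>\<^sub>M U) borel (\<lambda>(z, u). u * z)) (distr N N (\<lambda>n. n))"
    unfolding indep_sum_def
    by (subst pair_measure_distr)
      (simp_all add: N.sigma_finite_measure_axioms distr_distr comp_def split_beta')
  finally show ?thesis
    by (simp add: randomly_rotated_def)
qed

lemma nn_integral_randomly_rotated: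
  assumes [measurable]: "f \<in> borel_measurable borel"
  shows "(\<integral>\<^sup>+z. f z \<partial>randomly_rotated U F) = (\<integral>\<^sup>+u. \<integral>\<^sup>+z. f (u * z) \<partial>F \<partial>U)"
proof -
  have "(\<integral>\<^sup>+z. f z \<partial>randomly_rotated U F) = (\<integral>\<^sup>+p. f (snd p * fst p) \<partial>(F \<Otimes>\<^sub>M U))"
    by (simp add: randomly_rotated_def nn_integral_distr split_beta')
  then show ?thesis
    by (simp add: nn_integral_snd[symmetric])
qed

end

lemma nn_integral_rotated_gaussian:
  assumes "cmod u = 1" "P \<ge> 0" "Q > 0"
  shows "(\<integral>\<^sup>+w. gaussian_density Q (z - u * w) \<partial>complex_gaussian P) = gaussian_density (P + Q) z"
proof -
  interpret P: finite_power "complex_gaussian P"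
    using \<open>P \<ge> 0\<close> by (rule finite_power_complex_gaussian)
  interpret Q: gaussian_like_density "gaussian_density Q"
    using \<open>Q > 0\<close> by (rule gaussian_like_density_gaussian)
  have "cnj u * u = 1"
    using assms(1) by (metis complex_norm_square mult.commute of_real_1 power_one)
  then have "cnj u * (z - u * w) = cnj u * z - w" for w
    by (simp add: right_diff_distrib mult.assoc[symmetric])
  then have "gaussian_density Q (z - u * w) = gaussian_density Q (cnj u * z - w)" for w
    using gaussian_density_unit_mult[of "cnj u" Q "z - u * w"] assms(1) by simp
  then have "(\<integral>\<^sup>+w. gaussian_density Q (z - u * w) \<partial>complex_gaussian P) =
      smoothing (complex_gaussian P) (gaussian_density Q) (cnj u * z)"
    by (simp add: P.nn_integral_smoothing[OF Q.gaussian_like])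
  then show ?thesis
    using assms by (simp add: smoothing_gaussian gaussian_density_unit_mult)
qed

lemma smoothing_randomly_rotated_gaussian:
  assumes "phase_law U" "P \<ge> 0" "Q > 0"
  shows "smoothing (randomly_rotated U (complex_gaussian P)) (gaussian_density Q) =
    gaussian_density (P + Q)" (is "?q = _")
proof
  fix z
  interpret randomly_rotated_law U "complex_gaussian P"
    using assms by (simp add: randomly_rotated_law_def finite_power_complex_gaussian)
  interpret noise:
    additive_noise_channel "randomly_rotated U (complex_gaussian P)" "gaussian_density Q"
    using finite_power_randomly_rotated \<open>Q > 0\<close>
    by (simp add: additive_noise_channel_def gaussian_like_density_gaussian)
  have "ennreal (?q z) =
      (\<integral>\<^sup>+v. gaussian_density Q (z - v) \<partial>randomly_rotated U (complex_gaussian P))"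
    by (rule noise.X.nn_integral_smoothing[OF noise.W.gaussian_like
          noise.W.borel_measurable_density, symmetric])
  also have "\<dots> = (\<integral>\<^sup>+u. \<integral>\<^sup>+w. gaussian_density Q (z - u * w) \<partial>complex_gaussian P \<partial>U)"
    by (rule nn_integral_randomly_rotated) measurable
  also have "\<dots> = (\<integral>\<^sup>+u. gaussian_density (P + Q) z \<partial>U)"
    using U.AE_unit assms
    by (intro nn_integral_cong_AE) (auto elim!: eventually_mono simp: nn_integral_rotated_gaussian)
  also have "\<dots> = gaussian_density (P + Q) z"
    by (simp add: U.emeasure_space_1)
  finally show "?q z = gaussian_density (P + Q) z"
    using noise.R.density_pos[of z] gaussian_density_pos[of "P + Q" z] assms
    by (simp add: less_imp_le)
qed

lemma phase_law_phase_measure: "phase_law (phase_measure M)"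
proof (intro phase_law.intro phase_law_axioms.intro)
  show "prob_space (phase_measure M)"
    unfolding phase_measure_def by (rule measure_pmf.prob_space_distr) simp
  show "AE u in phase_measure M. cmod u = 1"
    unfolding phase_measure_def by (subst AE_distr_iff) auto
qed (simp add: phase_measure_def)

definition jammed_noise_density :: "nat \<Rightarrow> real \<Rightarrow> complex measure \<Rightarrow> complex \<Rightarrow> real" where
  "jammed_noise_density M PN FJ =
    smoothing (randomly_rotated (phase_measure M) FJ) (gaussian_density PN)"

locale jammed_channel =
  fixes M :: nat and PN :: real and FJ :: "complex measure"
  assumes PN_pos: "0 < PN" and finite_power_jammer: "finite_power FJ"
begin

sublocale jammer: randomly_rotated_law "phase_measure M" FJ
  using finite_power_jammer by (simp add: randomly_rotated_law_def phase_law_phase_measure)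

sublocale noise:
  additive_noise_channel "randomly_rotated (phase_measure M) FJ" "gaussian_density PN"
  rewrites "smoothing (randomly_rotated (phase_measure M) FJ) (gaussian_density PN) =
    jammed_noise_density M PN FJ"
  using PN_pos jammer.finite_power_randomly_rotated
  by (simp_all add: additive_noise_channel_def gaussian_like_density_gaussian
      jammed_noise_density_def)

lemma distr_jammed_noise:
  "distr (FJ \<Otimes>\<^sub>M (phase_measure M \<Otimes>\<^sub>M complex_gaussian PN)) borel (\<lambda>(j, u, n). u * j + n) =
    density lborel (jammed_noise_density M PN FJ)"
  using jammer.distr_rotated_plus_noise[OF noise.W.prob_space_axioms] PN_pos
  by (simp add: complex_gaussian_eq_density noise.indep_sum_eq_density_smoothing)

lemma mean_power_jammed_noise:
  "mean_power (density lborel (jammed_noise_density M PN FJ)) = mean_power FJ + PN"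
  using noise.mean_power_indep_sum PN_pos
  by (simp add: jammer.mean_power_randomly_rotated mean_power_complex_gaussian
      integral_complex_gaussian
      flip: noise.indep_sum_eq_density_smoothing complex_gaussian_eq_density)

lemma phi_eq_additive_noise_information:
  assumes "finite_power FS"
  shows "phi b M PN FS FJ =
    additive_noise_information b FS (density lborel (jammed_noise_density M PN FJ))"
proof -
  let ?N = "FJ \<Otimes>\<^sub>M (phase_measure M \<Otimes>\<^sub>M complex_gaussian PN)"
  interpret FS: finite_power FS by fact
  interpret G: finite_power "complex_gaussian PN"
    using PN_pos by (intro finite_power_complex_gaussian) simp
  interpret UG: pair_prob_space "phase_measure M" "complex_gaussian PN" ..
  interpret JUG: pair_prob_space FJ "phase_measure M \<Otimes>\<^sub>M complex_gaussian PN" ..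
  have "additive_noise_information b FS (distr ?N borel (\<lambda>(j, u, n). u * j + n)) =
      prob_space.mutual_information (FS \<Otimes>\<^sub>M ?N) b borel borel fst channel_output"
    by (subst additive_noise_information_distr)
      (simp_all add: FS.prob_space_axioms JUG.prob_space_axioms channel_output_def split_beta'
        add.assoc)
  then show ?thesis
    by (simp add: phi_def channel_space_def distr_jammed_noise)
qed

lemma phi_nonneg:
  assumes "1 < b" "finite_power FS"
  shows "0 \<le> phi b M PN FS FJ"
proof -
  interpret additive_noise_channel FS "jammed_noise_density M PN FJ"
    using assms noise.R.gaussian_like_density_axioms by (simp add: additive_noise_channel_def)
  show ?thesis
    using assms by (simp add: phi_eq_additive_noise_information additive_noise_information_nonneg)
qed

lemma phi_gaussian_signal_ge:
  assumes "1 < b" "0 \<le> PS" "mean_power FJ \<le> PJ"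
  shows "log b (1 + PS / (PJ + PN)) \<le> phi b M PN (complex_gaussian PS) FJ"
  using assms PN_pos mean_power_nonneg[of FJ]
    gaussian_signal_information_ge[of b PS "PJ + PN" "jammed_noise_density M PN FJ"]
  by (simp add: phi_eq_additive_noise_information finite_power_complex_gaussian
      noise.R.gaussian_like_density_axioms mean_power_jammed_noise)

end

lemma phi_gaussian_jammer_le:
  assumes "1 < b" "0 \<le> PJ" "0 < PN" "finite_power FS" "mean_power FS \<le> PS"
  shows "phi b M PN FS (complex_gaussian PJ) \<le> log b (1 + PS / (PJ + PN))"
proof -
  interpret jammed_channel M PN "complex_gaussian PJ"
    using assms by (simp add: jammed_channel_def finite_power_complex_gaussian)
  have "density lborel (jammed_noise_density M PN (complex_gaussian PJ)) =
      complex_gaussian (PJ + PN)"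
    using assms by (simp add: jammed_noise_density_def smoothing_randomly_rotated_gaussian
        phase_law_phase_measure complex_gaussian_eq_density)
  then show ?thesis
    using assms by (simp add: phi_eq_additive_noise_information gaussian_noise_information_le)
qed

theorem theorem3:
  fixes b PS PJ PN :: real and M :: nat
  assumes "b > 1" and "PS > 0" and "PJ \<ge> 0" and "PN > 0"
    and "M \<ge> 2" and "\<exists>k. M = 2 ^ k"
  shows "(SUP FS \<in> power_dists PS. INF FJ \<in> power_dists PJ. phi b M PN FS FJ)
           = log b (1 + PS / (PJ + PN)) \<and>
         (INF FJ \<in> power_dists PJ. phi b M PN (complex_gaussian PS) FJ)
           = log b (1 + PS / (PJ + PN)) \<and>
         complex_gaussian PS \<in> power_dists PS \<and>
         complex_gaussian PJ \<in> power_dists PJ \<and>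
         (\<forall>FS \<in> power_dists PS. \<forall>FJ \<in> power_dists PJ.
           phi b M PN FS (complex_gaussian PJ)
             \<le> phi b M PN (complex_gaussian PS) (complex_gaussian PJ) \<and>
           phi b M PN (complex_gaussian PS) (complex_gaussian PJ)
             \<le> phi b M PN (complex_gaussian PS) FJ) \<and>
         phi b M PN (complex_gaussian PS) (complex_gaussian PJ) = log b (1 + PS / (PJ + PN))"
proof -
  let ?\<phi> = "phi b M PN" and ?C = "log b (1 + PS / (PJ + PN))"
  have gaussians: "complex_gaussian PS \<in> power_dists PS" "complex_gaussian PJ \<in> power_dists PJ"
    using assms
    by (simp_all add: in_power_dists_iff finite_power_complex_gaussian mean_power_complex_gaussian)
  have jammer_bound: "?\<phi> FS (complex_gaussian PJ) \<le> ?C" if "FS \<in> power_dists PS" for FS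
    using assms that by (simp add: in_power_dists_iff phi_gaussian_jammer_le)
  have signal_bound: "?C \<le> ?\<phi> (complex_gaussian PS) FJ" if "FJ \<in> power_dists PJ" for FJ
    using assms that
    by (auto simp: in_power_dists_iff jammed_channel_def
        intro: jammed_channel.phi_gaussian_signal_ge)
  have saddle_value: "?\<phi> (complex_gaussian PS) (complex_gaussian PJ) = ?C"
    by (intro antisym jammer_bound signal_bound gaussians)
  have "bdd_below (?\<phi> FS ` power_dists PJ)" if "FS \<in> power_dists PS" for FS
    using assms that
    by (intro bdd_belowI2[where m = 0] jammed_channel.phi_nonneg)
      (simp_all add: in_power_dists_iff jammed_channel_def)
  note minimax =
    saddle_point_INF[where \<phi> = ?\<phi>, OF gaussians jammer_bound signal_bound this]
    saddle_point_SUP_INF[where \<phi> = ?\<phi>, OF gaussians jammer_bound signal_bound this]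
  show ?thesis
    by (simp add: minimax gaussians jammer_bound signal_bound saddle_value)
qed

end
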